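(* Assume $\mathcal Q_\Lambda^{\mathrm{cl}}\neq\{0\}$, gauge compatibility and the kernel-free condition for the clean detector (defined in the context). Let $\zeta_\ast(\mathcal D)\in\Gamma_\Lambda^{\mathrm{int}}$ be a selection of representatives and assume, for all intrinsic packages $\mathcal D$ (writing $\rho=\operatorname{dist}^{\sharp,\mathrm{tail}}(\mathcal D)$ and $\zeta_\ast=\zeta_\ast(\mathcal D)$): (1) (Chart visibility) with constants $\kappa_0,\kappa_{\mathrm{proj}},\kappa_{\mathrm{harm}}>0$ and $\delta_0,\delta_{\mathrm{proj}},\delta_{\mathrm{harm}}\ge0$, the number $\operatorname{dist}_{\mathrm{cl}}(\Theta_\Lambda\mathcal D,\Gamma_\Lambda^{\mathrm{cl}})$ is at least each of $\kappa_0\|\mathcal D-\zeta_\ast\|_{\mathrm{loc,int}}-\delta_0$, $\ \kappa_{\mathrm{proj}}\alpha_{\mathrm{proj}}\mathcal T_{\mathrm{proj}}(\mathcal D;\zeta_\ast)-\delta_{\mathrm{proj}}$, $\ \kappa_{\mathrm{harm}}\alpha_{\mathrm{harm}}\mathcal T_{\mathrm{harm}}(\mathcal D;\zeta_\ast)-\delta_{\mathrm{harm}}$. (2) (Same-gauge compatibility) $\rho=\|\mathcal D-\zeta_\ast\|_{\mathrm{loc,int}}+\alpha_{\mathrm{proj}}\mathcal T_{\mathrm{proj}}(\mathcal D;\zeta_\ast)+\alpha_{\mathrm{harm}}\mathcal T_{\mathrm{harm}}(\mathcal D;\zeta_\ast)$ and $\mathcal R_{\mathrm{core}}(\mathcal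 D)\le\eta_{\mathrm{core}}\rho+\Delta_{\mathrm{core}}$ with constants $\eta_{\mathrm{core}},\Delta_{\mathrm{core}}\ge0$. (3) (Detector and residual sub-budgets) with $\mathsf{Err}_{\Lambda,\mathrm{dec}}^{\mathrm{loc}}=\mathcal R_{\mathrm{core}}+\mathcal R_{\mathrm{tail}}+\mathcal R_{\mathrm{chart}}+\mathcal R_{\mathrm{loc}}+\mathcal R_{\mathrm{rep}}+\mathcal R_{\mathrm{gate}}$ one has $\mathcal M_\Lambda^{\mathrm{loc}}(\mathcal D)+\mathsf{Err}_{\Lambda,\mathrm{dec}}^{\mathrm{loc}}(\mathcal D)\ge\mathcal M_\Lambda^{\mathrm{comp}}(\Theta_\Lambda\mathcal D)$, and for each $a\in\{\mathrm{chart},\mathrm{loc},\mathrm{rep},\mathrm{gate}\}$ there are constants $\eta_a,\Delta_a\ge0$ with $\mathcal R_a(\mathcal D)\le\eta_a\rho+\Delta_a$. Set $\lambda_G=\min\{1,\tfrac13\min\{\kappa_0,\kappa_{\mathrm{proj}},\kappa_{\mathrm{harm}}\}\}$, $\delta_G^{\mathrm{vis}}=\tfrac13(\delta_0+\delta_{\mathrm{proj}}+\delta_{\mathrm{harm}})$, $$\eta_{\mathrm{dec}}=\eta_{\mathrm{core}}+\max\{\alpha_{\mathrm{proj}}^{-1},\alpha_{\mathrm{harm}}^{-1}\}+\eta_{\mathrm{chart}}+\eta_{\mathrm{loc}}+\eta_{\mathrm{rep}}+\eta_{\mathrm{gate}},$$ $$\Delta_{\mathrm{dec}}=\Delta_{\mathrm{core}}+\Delta_{\mathrm{chart}}+\Delta_{\mathrm{loc}}+\Delta_{\mathrm{rep}}+\Delta_{\mathrm{gate}}.$$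 Then every intrinsic package $\mathcal D$ satisfies $$\mathcal M_\Lambda^{\mathrm{loc}}(\mathcal D)\ge\big(\mu_\Lambda^{\mathrm{comp}}\lambda_G-\eta_{\mathrm{dec}}\big)\operatorname{dist}^{\sharp,\mathrm{tail}}(\mathcal D)-\mu_\Lambda^{\mathrm{comp}}\delta_G^{\mathrm{vis}}-\Delta_{\mathrm{dec}}.$$
   Context: Clean setting. Let $\Lambda=\{k_0,\dots,k_0+L\}$ be a finite set of consecutive integers, $\Lambda_{\mathrm{adj}}=\{k\in\Lambda: k+1\in\Lambda\}$. For $k\in\Lambda$ let $\mathcal D_k^{\mathrm{cl}}$ be a finite-dimensional real normed space with norm $\|\cdot\|_{\mathrm{cl},k}$; $\mathcal D_\Lambda^{\mathrm{cl}}=\prod_{k}\mathcal D_k^{\mathrm{cl}}$ carries a fixed norm $\|\cdot\|_{\mathrm{cl}}$, and $\mathcal K_\Lambda^{\mathrm{cl}}\subset\mathcal D_\Lambda^{\mathrm{cl}}$ is a linear subspace. $G_\Lambda^{\mathrm{cl}}:\mathcal C_\Lambda^{\mathrm{cl}}\to\mathcal D_\Lambda^{\mathrm{cl}}$ is linear from a finite-dimensional real normed space, $\Gamma_\Lambda^{\mathrm{cl}}=\mathcal K_\Lambda^{\mathrm{cl}}\cap\operatorname{Im}G_\Lambda^{\mathrm{cl}}$, $\operatorname{dist}_{\mathrm{cl}}(d,\Gamma_\Lambda^{\mathrm{cl}})=\inf_{\gamma\in\Gamma_\Lambda^{\mathrm{cl}}}\|d-\gamma\|_{\mathrm{cl}}$,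 which is the quotient norm on $\mathcal Q_\Lambda^{\mathrm{cl}}=\mathcal K_\Lambda^{\mathrm{cl}}/\Gamma_\Lambda^{\mathrm{cl}}$; $S_\Lambda^{\mathrm{cl}}$ is its unit sphere. $O_\Lambda^{\mathrm{cl}}$ is a linear map from $\mathcal K_\Lambda^{\mathrm{cl}}$ to a finite product of finite-dimensional normed spaces (with a fixed norm). For fixed linear $R_k^{\mathrm{cl}}:\mathcal D_k^{\mathrm{cl}}\to\mathcal D_{k+1}^{\mathrm{cl}}$, $\operatorname{Rep}_\Lambda^{\mathrm{cl}}(d)=\big(\sum_{k\in\Lambda_{\mathrm{adj}}}\|d_{k+1}-R_k^{\mathrm{cl}}d_k\|_{\mathrm{cl},k+1}^2\big)^{1/2}$. $\operatorname{Tax}_\Lambda^{\mathrm{cl}}:\mathcal K_\Lambda^{\mathrm{cl}}\to[0,\infty)$ is continuous with $\operatorname{Tax}_\Lambda^{\mathrm{cl}}(\lambda d)=|\lambda|\operatorname{Tax}_\Lambda^{\mathrm{cl}}(d)$. For fixed $C_R,C_T>0$, $\mathcal M_\Lambda^{\mathrm{comp}}(d)=\|O_\Lambda^{\mathrm{cl}}d\|+C_R\operatorname{Rep}_\Lambda^{\mathrm{cl}}(d)+C_T\operatorname{Tax}_\Lambda^{\mathrm{cl}}(d)$. Gauge compatibility: $O_\Lambda^{\mathrm{cl}}$, $\operatorname{Rep}_\Lambda^{\mathrm{cl}}$, $\operatorname{Tax}_\Lambda^{\mathrm{cl}}$ are each unchanged when $d\in\mathcal K_\Lambda^{\mathrm{cl}}$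 is replaced by $d+\gamma$, $\gamma\in\Gamma_\Lambda^{\mathrm{cl}}$. Kernel-free condition: if $d\in\mathcal K_\Lambda^{\mathrm{cl}}$ and $O_\Lambda^{\mathrm{cl}}d=0$, $\operatorname{Rep}_\Lambda^{\mathrm{cl}}(d)=0$, $\operatorname{Tax}_\Lambda^{\mathrm{cl}}(d)=0$, then $d\in\Gamma_\Lambda^{\mathrm{cl}}$. Under gauge compatibility $\mathcal M_\Lambda^{\mathrm{comp}}$ descends to $\overline{\mathcal M}_\Lambda^{\mathrm{comp}}$ on $\mathcal Q_\Lambda^{\mathrm{cl}}$, and $\mu_\Lambda^{\mathrm{comp}}=\inf_{q\in S_\Lambda^{\mathrm{cl}}}\overline{\mathcal M}_\Lambda^{\mathrm{comp}}(q)$. Intrinsic packages. For $k\in\Lambda$, $j=1,\dots,7$, let $X_k^{(j)}$ be normed spaces; an intrinsic package is $\mathcal D=(x_k^{(j)})_{k,j}$, $x_k^{(j)}\in X_k^{(j)}$, with norm $\|\mathcal D\|_{\mathrm{loc,int}}^2=\sum_{k}\sum_{j}a_j\|x_k^{(j)}\|^2$, $a_j>0$ fixed; $\mathfrak I_\Lambda^{\mathrm{loc}}$ is the space of intrinsic packages and $\Gamma_\Lambda^{\mathrm{int}}\subset\mathfrak I_\Lambda^{\mathrm{loc}}$ a linear subspace. $\Theta_\Lambda:\mathfrak I_\Lambda^{\mathrm{loc}}\to\mathcal K_\Lambda^{\mathrm{cl}}$ is a map; $\mathcal M_\Lambda^{\mathrm{loc}}$ and the residual functionals $\mathcal R_{\mathrm{chart}},\mathcal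 R_{\mathrm{loc}},\mathcal R_{\mathrm{rep}},\mathcal R_{\mathrm{gate}}$ are functions $\mathfrak I_\Lambda^{\mathrm{loc}}\to[0,\infty)$. Pressure data. $B_r\subset\mathbb R^3$ is the ball of radius $r$ about $0$, $I=(-1,0)$, $A_{3/4,1}=B_1\setminus B_{3/4}$, $\eta\in C_c^\infty(B_1)$, $\eta\equiv1$ on $B_{3/4}$, $Y_{\mathrm{prs}}=L^{3/2}(I;L^{3/2}(B_{1/2}))$; $\mathsf R_i$ are the Riesz transforms on $\mathbb R^3$ (tensors on $B_1$ extended by zero, repeated indices summed, results restricted to $B_{1/2}$). Each package $\mathcal D$ carries a velocity $u(\mathcal D)\in L^3(I;L^3(B_1))^3$ linear in $\mathcal D$, clean coordinates $U,R$ with $F^{\mathrm{cl}}_{ij}=U_iU_j+R_{ij}\in L^{3/2}(I;L^{3/2}(B_1))$, and a harmonic pressure $p_{\mathrm{harm}}(\mathcal D)$ in a normed space $Y_{\mathrm{harm}}$; $M^{\mathrm{act}}_{ij}=\eta u_iu_j-F_{ij}^{\mathrm{cl}}$; a subscript $\zeta$ means evaluation at $\mathcal D-\zeta$. $P_{\mathrm{prs},N}^{\mathrm{cl}}$ is a bounded linear projection on $Y_{\mathrm{prs}}$, $\Pi_{\mathrm{harm},M}$ a bounded projection of $Y_{\mathrm{harm}}$ onto a finite-dimensional subspace, $J_{\mathrm{harm}}:Y_{\mathrm{harm}}\to Y_{\mathrm{prs}}$ bounded linear. $\mathcal T_{\mathrm{proj}}(\mathcal D;\zeta)=(1+\|P_{\mathrm{prs},N}^{\mathrm{cl}}\|)\|\mathsf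 R_i\mathsf R_jF_{\zeta,ij}^{\mathrm{cl}}\|_{Y_{\mathrm{prs}}}$, $\mathcal T_{\mathrm{harm}}(\mathcal D;\zeta)=\|J_{\mathrm{harm}}\|\,\|(I-\Pi_{\mathrm{harm},M})p_{\mathrm{harm},\zeta}\|_{Y_{\mathrm{harm}}}$, and for fixed $\alpha_{\mathrm{proj}},\alpha_{\mathrm{harm}}>0$, $$\operatorname{dist}^{\sharp,\mathrm{tail}}(\mathcal D)=\inf_{\zeta\in\Gamma_\Lambda^{\mathrm{int}}}\big(\|\mathcal D-\zeta\|_{\mathrm{loc,int}}+\alpha_{\mathrm{proj}}\mathcal T_{\mathrm{proj}}(\mathcal D;\zeta)+\alpha_{\mathrm{harm}}\mathcal T_{\mathrm{harm}}(\mathcal D;\zeta)\big).$$ $\mathcal R_{\mathrm{core}}(\mathcal D)=2C_\eta\|u_{\zeta_\ast}\|^2_{L^3(I;L^3(A_{3/4,1}))}+C_{\mathrm{Riesz}}\|M^{\mathrm{act}}_{\zeta_\ast}\|_{L^{3/2}(I;L^{3/2}(B_1))^{3\times3}}$, where $C_\eta,C_{\mathrm{Riesz}}<\infty$ are fixed constants (a cutoff-commutator constant and the $L^{3/2}$ bound of $\mathsf R_i\mathsf R_j$), and $\mathcal R_{\mathrm{tail}}(\mathcal D)=\inf_{\zeta\in\Gamma_\Lambda^{\mathrm{int}}}\mathcal T_{\mathrm{proj}}(\mathcal D;\zeta)+\inf_{\zeta\in\Gamma_\Lambda^{\mathrm{int}}}\mathcal T_{\mathrm{harm}}(\mathcal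 D;\zeta)$. *)

theory Defs
  imports "HOL-Analysis.Analysis" "HOL-Library.Function_Algebras"
begin

section \<open>Functions as a real vector space\<close>

instantiation "fun" :: (type, real_vector) real_vector
begin

definition scaleR_fun :: "real \<Rightarrow> ('a \<Rightarrow> 'b) \<Rightarrow> 'a \<Rightarrow> 'b"
  where "scaleR_fun c f = (\<lambda>x. c *\<^sub>R f x)"

instance
  by standard (simp_all add: scaleR_fun_def fun_eq_iff scaleR_add_right scaleR_add_left)

end

section \<open>Normed spaces on carriers and their finite products\<close>

text \<open>
  A family of real normed spaces \<open>V\<^sub>i\<close> of possibly different dimensions is given by subspaces
  \<open>V i\<close> of one ambient real vector space together with a norm on each of them. No norm or topology
  of the ambient space is involved, and any family can be put into this form, by taking the direct
  sum of its members as the ambient space.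
\<close>

definition normed_subspace :: "'a::real_vector set \<Rightarrow> ('a \<Rightarrow> real) \<Rightarrow> bool" where
  "normed_subspace V n \<longleftrightarrow> subspace V
     \<and> (\<forall>x\<in>V. 0 \<le> n x \<and> (n x = 0 \<longleftrightarrow> x = 0))
     \<and> (\<forall>x\<in>V. \<forall>c. n (c *\<^sub>R x) = \<bar>c\<bar> * n x)
     \<and> (\<forall>x\<in>V. \<forall>y\<in>V. n (x + y) \<le> n x + n y)"

definition fin_dim :: "'a::real_vector set \<Rightarrow> bool" where
  "fin_dim V \<longleftrightarrow> (\<exists>B. finite B \<and> V = span B)"

definition linear_between ::
    "'a::real_vector set \<Rightarrow> 'b::real_vector set \<Rightarrow> ('a \<Rightarrow> 'b) \<Rightarrow> bool" where
  "linear_between V W f \<longleftrightarrow> f ` V \<subseteq> W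
     \<and> (\<forall>x\<in>V. \<forall>y\<in>V. f (x + y) = f x + f y)
     \<and> (\<forall>x\<in>V. \<forall>c. f (c *\<^sub>R x) = c *\<^sub>R f x)"

text \<open>The value outside the index set is fixed to \<open>0\<close>, so that equality of elements of the product
  is equality of functions.\<close>

definition prod_space :: "'i set \<Rightarrow> ('i \<Rightarrow> 'a::zero set) \<Rightarrow> ('i \<Rightarrow> 'a) set" where
  "prod_space A V = {x. (\<forall>i\<in>A. x i \<in> V i) \<and> (\<forall>i. i \<notin> A \<longrightarrow> x i = 0)}"

definition op_norm :: "'a set \<Rightarrow> ('a \<Rightarrow> real) \<Rightarrow> ('b \<Rightarrow> real) \<Rightarrow> ('a \<Rightarrow> 'b) \<Rightarrow> real" where
  "op_norm V nV nW T = (SUP v\<in>{v\<in>V. nV v \<le> 1}. nW (T v))"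

section \<open>The clean detector\<close>

record ('d, 'c, 'o) clean_data =
  first_scale :: int
  num_steps :: nat
  D_cl :: "int \<Rightarrow> 'd set"
  norm_D_cl :: "int \<Rightarrow> 'd \<Rightarrow> real"
  norm_cl :: "(int \<Rightarrow> 'd) \<Rightarrow> real"
  K_cl :: "(int \<Rightarrow> 'd) set"
  G_cl :: "'c \<Rightarrow> int \<Rightarrow> 'd"
  num_obs :: nat
  Obs_space :: "nat \<Rightarrow> 'o set"
  norm_Obs_space :: "nat \<Rightarrow> 'o \<Rightarrow> real"
  norm_Obs :: "(nat \<Rightarrow> 'o) \<Rightarrow> real"
  O_cl :: "(int \<Rightarrow> 'd) \<Rightarrow> nat \<Rightarrow> 'o"
  R_cl :: "int \<Rightarrow> 'd \<Rightarrow> 'd"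
  Tax_cl :: "(int \<Rightarrow> 'd) \<Rightarrow> real"
  const_R :: real
  const_T :: real

definition scales :: "('d, 'c, 'o) clean_data \<Rightarrow> int set" where
  "scales C = {first_scale C .. first_scale C + int (num_steps C)}"

definition scales_adj :: "('d, 'c, 'o) clean_data \<Rightarrow> int set" where
  "scales_adj C = {k \<in> scales C. k + 1 \<in> scales C}"

definition D_cl_prod :: "('d::real_vector, 'c, 'o) clean_data \<Rightarrow> (int \<Rightarrow> 'd) set" where
  "D_cl_prod C = prod_space (scales C) (D_cl C)"

definition Obs_prod :: "('d, 'c, 'o::real_vector) clean_data \<Rightarrow> (nat \<Rightarrow> 'o) set" where
  "Obs_prod C = prod_space {..<num_obs C} (Obs_space C)"

definition Gamma_cl :: "('d, 'c, 'o) clean_data \<Rightarrow> (int \<Rightarrow> 'd) set" where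
  "Gamma_cl C = K_cl C \<inter> range (G_cl C)"

definition dist_cl :: "('d::real_vector, 'c, 'o) clean_data \<Rightarrow> (int \<Rightarrow> 'd) \<Rightarrow> real" where
  "dist_cl C d = (INF \<gamma>\<in>Gamma_cl C. norm_cl C (d - \<gamma>))"

definition Rep_cl :: "('d::real_vector, 'c, 'o) clean_data \<Rightarrow> (int \<Rightarrow> 'd) \<Rightarrow> real" where
  "Rep_cl C d =
     sqrt (\<Sum>k\<in>scales_adj C. (norm_D_cl C (k + 1) (d (k + 1) - R_cl C k (d k)))\<^sup>2)"

definition M_comp :: "('d::real_vector, 'c, 'o) clean_data \<Rightarrow> (int \<Rightarrow> 'd) \<Rightarrow> real" where
  "M_comp C d = norm_Obs C (O_cl C d) + const_R C * Rep_cl C d + const_T C * Tax_cl C d"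

definition clean_setting ::
    "('d::real_vector, 'c::real_normed_vector, 'o::real_vector) clean_data \<Rightarrow> bool" where
  "clean_setting C \<longleftrightarrow>
     (\<forall>k\<in>scales C. fin_dim (D_cl C k) \<and> normed_subspace (D_cl C k) (norm_D_cl C k))
   \<and> normed_subspace (D_cl_prod C) (norm_cl C)
   \<and> subspace (K_cl C) \<and> K_cl C \<subseteq> D_cl_prod C
   \<and> fin_dim (UNIV :: 'c set) \<and> linear_between UNIV (D_cl_prod C) (G_cl C)
   \<and> (\<forall>i<num_obs C. fin_dim (Obs_space C i)
        \<and> normed_subspace (Obs_space C i) (norm_Obs_space C i))
   \<and> normed_subspace (Obs_prod C) (norm_Obs C)
   \<and> linear_between (K_cl C) (Obs_prod C) (O_cl C)
   \<and> (\<forall>k\<in>scales_adj C. linear_between (D_cl C k) (D_cl C (k + 1)) (R_cl C k))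
   \<and> (\<forall>d\<in>K_cl C. 0 \<le> Tax_cl C d)
   \<and> (\<forall>d\<in>K_cl C. \<forall>c. Tax_cl C (c *\<^sub>R d) = \<bar>c\<bar> * Tax_cl C d)
   \<and> continuous_map (Metric_space.mtopology (K_cl C) (\<lambda>d d'. norm_cl C (d - d')))
        euclideanreal (Tax_cl C)
   \<and> 0 < const_R C \<and> 0 < const_T C"

definition gauge_compatible :: "('d::real_vector, 'c, 'o) clean_data \<Rightarrow> bool" where
  "gauge_compatible C \<longleftrightarrow> (\<forall>d\<in>K_cl C. \<forall>\<gamma>\<in>Gamma_cl C.
     O_cl C (d + \<gamma>) = O_cl C d \<and> Rep_cl C (d + \<gamma>) = Rep_cl C d \<and> Tax_cl C (d + \<gamma>) = Tax_cl C d)"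

definition kernel_free :: "('d::real_vector, 'c, 'o::real_vector) clean_data \<Rightarrow> bool" where
  "kernel_free C \<longleftrightarrow> (\<forall>d\<in>K_cl C.
     O_cl C d = 0 \<and> Rep_cl C d = 0 \<and> Tax_cl C d = 0 \<longrightarrow> d \<in> Gamma_cl C)"

text \<open>The quotient \<open>K / \<Gamma>\<close> is the set of cosets. A functional that is constant on cosets, such as
  \<open>dist_cl\<close> or (under gauge compatibility) \<open>M_comp\<close>, descends to it by \<^const>\<open>the_elem\<close> of the image
  of the coset.\<close>

definition gauge_rel :: "('d::real_vector, 'c, 'o) clean_data \<Rightarrow> ((int \<Rightarrow> 'd) \<times> (int \<Rightarrow> 'd)) set" where
  "gauge_rel C = {(d, d'). d \<in> K_cl C \<and> d' \<in> K_cl C \<and> d - d' \<in> Gamma_cl C}"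

definition Q_cl :: "('d::real_vector, 'c, 'o) clean_data \<Rightarrow> (int \<Rightarrow> 'd) set set" where
  "Q_cl C = K_cl C // gauge_rel C"

definition Q_cl_zero :: "('d::real_vector, 'c, 'o) clean_data \<Rightarrow> (int \<Rightarrow> 'd) set" where
  "Q_cl_zero C = gauge_rel C `` {0}"

definition Q_cl_norm :: "('d::real_vector, 'c, 'o) clean_data \<Rightarrow> (int \<Rightarrow> 'd) set \<Rightarrow> real" where
  "Q_cl_norm C q = the_elem (dist_cl C ` q)"

definition S_cl :: "('d::real_vector, 'c, 'o) clean_data \<Rightarrow> (int \<Rightarrow> 'd) set set" where
  "S_cl C = {q \<in> Q_cl C. Q_cl_norm C q = 1}"

definition M_comp_bar :: "('d::real_vector, 'c, 'o) clean_data \<Rightarrow> (int \<Rightarrow> 'd) set \<Rightarrow> real" where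
  "M_comp_bar C q = the_elem (M_comp C ` q)"

definition mu_comp :: "('d::real_vector, 'c, 'o) clean_data \<Rightarrow> real" where
  "mu_comp C = (INF q\<in>S_cl C. M_comp_bar C q)"

section \<open>Intrinsic packages\<close>

text \<open>A package is a function of the pair \<open>(k, j)\<close> with \<open>k\<close> a scale and \<open>1 \<le> j \<le> 7\<close>.\<close>

record 'x intrinsic_data =
  X_space :: "int \<Rightarrow> nat \<Rightarrow> 'x set"
  norm_X :: "int \<Rightarrow> nat \<Rightarrow> 'x \<Rightarrow> real"
  weight :: "nat \<Rightarrow> real"
  Gamma_int :: "(int \<times> nat \<Rightarrow> 'x) set"

definition packages :: "int set \<Rightarrow> 'x::real_vector intrinsic_data \<Rightarrow> (int \<times> nat \<Rightarrow> 'x) set" where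
  "packages \<Lambda> N = prod_space (\<Lambda> \<times> {1..7}) (\<lambda>(k, j). X_space N k j)"

definition norm_loc_int :: "int set \<Rightarrow> 'x intrinsic_data \<Rightarrow> (int \<times> nat \<Rightarrow> 'x) \<Rightarrow> real" where
  "norm_loc_int \<Lambda> N D = sqrt (\<Sum>k\<in>\<Lambda>. \<Sum>j = 1..7. weight N j * (norm_X N k j (D (k, j)))\<^sup>2)"

definition intrinsic_setting :: "int set \<Rightarrow> 'x::real_vector intrinsic_data \<Rightarrow> bool" where
  "intrinsic_setting \<Lambda> N \<longleftrightarrow>
     (\<forall>k\<in>\<Lambda>. \<forall>j\<in>{1..7}. normed_subspace (X_space N k j) (norm_X N k j))
   \<and> (\<forall>j\<in>{1..7}. 0 < weight N j)
   \<and> subspace (Gamma_int N) \<and> Gamma_int N \<subseteq> packages \<Lambda> N"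

section \<open>Lebesgue spaces and Riesz transforms\<close>

text \<open>Elements of Lebesgue spaces are represented by functions, and linearity and equality of
  such elements are required almost everywhere. The space \<open>L\<^sup>p(T; L\<^sup>p(S))\<close> consists of the jointly
  measurable \<open>f\<close> with \<open>|f|\<^sup>p\<close> integrable over \<open>T \<times> S\<close>.\<close>

definition Lp_space :: "real \<Rightarrow> 'a::euclidean_space set \<Rightarrow> ('a \<Rightarrow> 'b::euclidean_space) set" where
  "Lp_space p S = {f. set_borel_measurable lebesgue S f
     \<and> set_integrable lebesgue S (\<lambda>x. norm (f x) powr p)}"

definition Lp_norm ::
    "real \<Rightarrow> 'a::euclidean_space set \<Rightarrow> ('a \<Rightarrow> 'b::euclidean_space) \<Rightarrow> real" where
  "Lp_norm p S f = (LINT x:S|lebesgue. norm (f x) powr p) powr (1 / p)"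

definition LpLp_space ::
    "real \<Rightarrow> real set \<Rightarrow> (real^3) set \<Rightarrow> (real \<Rightarrow> real^3 \<Rightarrow> 'b::euclidean_space) set" where
  "LpLp_space p T S = {f. case_prod f \<in> Lp_space p (T \<times> S)}"

definition LpLp_norm ::
    "real \<Rightarrow> real set \<Rightarrow> (real^3) set \<Rightarrow> (real \<Rightarrow> real^3 \<Rightarrow> 'b::euclidean_space) \<Rightarrow> real" where
  "LpLp_norm p T S f = Lp_norm p T (\<lambda>t. Lp_norm p S (f t))"

definition ae_eq ::
    "real set \<Rightarrow> (real^3) set \<Rightarrow> (real \<Rightarrow> real^3 \<Rightarrow> 'b) \<Rightarrow> (real \<Rightarrow> real^3 \<Rightarrow> 'b) \<Rightarrow> bool" where
  "ae_eq T S f g \<longleftrightarrow> (AE (t, x) in lebesgue. t \<in> T \<and> x \<in> S \<longrightarrow> f t x = g t x)"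

text \<open>The Riesz transform on \<open>\<real>\<^sup>3\<close> as a principal value integral; the constant is
  \<open>\<Gamma>(2) / \<pi>\<^sup>2 = 1 / \<pi>\<^sup>2\<close>.\<close>

definition riesz :: "3 \<Rightarrow> (real^3 \<Rightarrow> real) \<Rightarrow> real^3 \<Rightarrow> real" where
  "riesz j f x = Lim (at_right 0) (\<lambda>\<epsilon>.
     1 / pi\<^sup>2 * (LINT y:{y. \<epsilon> < norm (x - y)}|lebesgue. (x $ j - y $ j) / norm (x - y) ^ 4 * f y))"

text \<open>\<open>R\<^sub>i R\<^sub>j F\<^sub>i\<^sub>j\<close>, summed over \<open>i\<close> and \<open>j\<close>, at each time, with \<open>F\<close> extended from the unit ball by
  zero.\<close>

definition riesz_riesz :: "(real \<Rightarrow> real^3 \<Rightarrow> real^3^3) \<Rightarrow> real \<Rightarrow> real^3 \<Rightarrow> real" where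
  "riesz_riesz F t x =
     (\<Sum>i\<in>UNIV. \<Sum>j\<in>UNIV. riesz i (riesz j (\<lambda>y. indicator (ball 0 1) y * F t y $ i $ j)) x)"

text \<open>Iterated directional derivatives. If all of them along basis vectors are differentiable,
  then all of them are continuous, so this is \<open>C\<^sup>\<infinity>\<close>.\<close>

fun iter_deriv :: "'a::euclidean_space list \<Rightarrow> ('a \<Rightarrow> real) \<Rightarrow> 'a \<Rightarrow> real" where
  "iter_deriv [] f = f"
| "iter_deriv (v # vs) f = (\<lambda>x. frechet_derivative (iter_deriv vs f) (at x) v)"

definition smooth :: "('a::euclidean_space \<Rightarrow> real) \<Rightarrow> bool" where
  "smooth f \<longleftrightarrow> (\<forall>vs. set vs \<subseteq> Basis \<longrightarrow> (\<forall>x. iter_deriv vs f differentiable (at x)))"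

section \<open>Pressure data\<close>

abbreviation time_I :: "real set" where "time_I \<equiv> {-1<..<0}"

abbreviation Y_prs :: "(real \<Rightarrow> real^3 \<Rightarrow> real) set" where
  "Y_prs \<equiv> LpLp_space (3/2) time_I (ball 0 (1/2))"

abbreviation Y_prs_norm :: "(real \<Rightarrow> real^3 \<Rightarrow> real) \<Rightarrow> real" where
  "Y_prs_norm \<equiv> LpLp_norm (3/2) time_I (ball 0 (1/2))"

abbreviation Y_prs_eq :: "(real \<Rightarrow> real^3 \<Rightarrow> real) \<Rightarrow> (real \<Rightarrow> real^3 \<Rightarrow> real) \<Rightarrow> bool" where
  "Y_prs_eq \<equiv> ae_eq time_I (ball 0 (1/2))"

record ('x, 'h) pressure_data =
  cutoff :: "real^3 \<Rightarrow> real"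
  velocity :: "(int \<times> nat \<Rightarrow> 'x) \<Rightarrow> real \<Rightarrow> real^3 \<Rightarrow> real^3"
  clean_U :: "(int \<times> nat \<Rightarrow> 'x) \<Rightarrow> real \<Rightarrow> real^3 \<Rightarrow> real^3"
  clean_R :: "(int \<times> nat \<Rightarrow> 'x) \<Rightarrow> real \<Rightarrow> real^3 \<Rightarrow> real^3^3"
  p_harm :: "(int \<times> nat \<Rightarrow> 'x) \<Rightarrow> 'h"
  P_prs :: "(real \<Rightarrow> real^3 \<Rightarrow> real) \<Rightarrow> real \<Rightarrow> real^3 \<Rightarrow> real"
  Pi_harm :: "'h \<Rightarrow> 'h"
  J_harm :: "'h \<Rightarrow> real \<Rightarrow> real^3 \<Rightarrow> real"
  alpha_proj :: real
  alpha_harm :: real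
  C_eta :: real
  C_Riesz :: real

definition F_cl ::
    "('x, 'h) pressure_data \<Rightarrow> (int \<times> nat \<Rightarrow> 'x) \<Rightarrow> real \<Rightarrow> real^3 \<Rightarrow> real^3^3" where
  "F_cl P D t x = (\<chi> i j. clean_U P D t x $ i * clean_U P D t x $ j + clean_R P D t x $ i $ j)"

definition M_act ::
    "('x, 'h) pressure_data \<Rightarrow> (int \<times> nat \<Rightarrow> 'x) \<Rightarrow> real \<Rightarrow> real^3 \<Rightarrow> real^3^3" where
  "M_act P D t x =
     (\<chi> i j. cutoff P x * velocity P D t x $ i * velocity P D t x $ j - F_cl P D t x $ i $ j)"

text \<open>Here \<open>pk\<close> is the space of packages. The last condition says that \<open>C_Riesz\<close> bounds every
  \<open>R\<^sub>i R\<^sub>j\<close> on \<open>L\<^sup>3\<^sup>/\<^sup>2(\<real>\<^sup>3)\<close>. The operators \<open>P_prs\<close> and \<open>J_harm\<close> are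
  linear up to null sets and bounded, hence compatible with almost everywhere equality.\<close>

definition pressure_setting ::
    "(int \<times> nat \<Rightarrow> 'x::real_vector) set \<Rightarrow> ('x, 'h::real_normed_vector) pressure_data \<Rightarrow> bool" where
  "pressure_setting pk P \<longleftrightarrow>
     smooth (cutoff P)
   \<and> (\<exists>K. compact K \<and> K \<subseteq> ball 0 1 \<and> (\<forall>x. x \<notin> K \<longrightarrow> cutoff P x = 0))
   \<and> (\<forall>x\<in>ball 0 (3/4). cutoff P x = 1)
   \<and> (\<forall>D\<in>pk. velocity P D \<in> LpLp_space 3 time_I (ball 0 1))
   \<and> (\<forall>D\<in>pk. \<forall>D'\<in>pk. \<forall>a b. ae_eq time_I (ball 0 1)
        (velocity P (a *\<^sub>R D + b *\<^sub>R D')) (a *\<^sub>R velocity P D + b *\<^sub>R velocity P D'))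
   \<and> (\<forall>D\<in>pk. F_cl P D \<in> LpLp_space (3/2) time_I (ball 0 1))
   \<and> (\<forall>f\<in>Y_prs. P_prs P f \<in> Y_prs)
   \<and> (\<forall>f\<in>Y_prs. \<forall>g\<in>Y_prs. \<forall>a b.
        Y_prs_eq (P_prs P (a *\<^sub>R f + b *\<^sub>R g)) (a *\<^sub>R P_prs P f + b *\<^sub>R P_prs P g))
   \<and> (\<exists>c. \<forall>f\<in>Y_prs. Y_prs_norm (P_prs P f) \<le> c * Y_prs_norm f)
   \<and> (\<forall>f\<in>Y_prs. Y_prs_eq (P_prs P (P_prs P f)) (P_prs P f))
   \<and> bounded_linear (Pi_harm P) \<and> (\<forall>h. Pi_harm P (Pi_harm P h) = Pi_harm P h)
   \<and> fin_dim (range (Pi_harm P))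
   \<and> (\<forall>h. J_harm P h \<in> Y_prs)
   \<and> (\<forall>h h' a b. Y_prs_eq (J_harm P (a *\<^sub>R h + b *\<^sub>R h')) (a *\<^sub>R J_harm P h + b *\<^sub>R J_harm P h'))
   \<and> (\<exists>c. \<forall>h. Y_prs_norm (J_harm P h) \<le> c * norm h)
   \<and> 0 < alpha_proj P \<and> 0 < alpha_harm P
   \<and> 0 \<le> C_eta P \<and> 0 \<le> C_Riesz P
   \<and> (\<forall>i j. \<forall>f\<in>Lp_space (3/2) UNIV.
        Lp_norm (3/2) UNIV (riesz i (riesz j f)) \<le> C_Riesz P * Lp_norm (3/2) UNIV f)"

definition T_proj ::
    "('x::real_vector, 'h) pressure_data \<Rightarrow> (int \<times> nat \<Rightarrow> 'x) \<Rightarrow> (int \<times> nat \<Rightarrow> 'x) \<Rightarrow> real" where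
  "T_proj P D \<zeta> =
     (1 + op_norm Y_prs Y_prs_norm Y_prs_norm (P_prs P)) * Y_prs_norm (riesz_riesz (F_cl P (D - \<zeta>)))"

definition T_harm ::
    "('x::real_vector, 'h::real_normed_vector) pressure_data
      \<Rightarrow> (int \<times> nat \<Rightarrow> 'x) \<Rightarrow> (int \<times> nat \<Rightarrow> 'x) \<Rightarrow> real" where
  "T_harm P D \<zeta> =
     op_norm UNIV norm Y_prs_norm (J_harm P) * norm (p_harm P (D - \<zeta>) - Pi_harm P (p_harm P (D - \<zeta>)))"

definition dist_tail ::
    "int set \<Rightarrow> 'x::real_vector intrinsic_data \<Rightarrow> ('x, 'h::real_normed_vector) pressure_data
      \<Rightarrow> (int \<times> nat \<Rightarrow> 'x) \<Rightarrow> real" where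
  "dist_tail \<Lambda> N P D = (INF \<zeta>\<in>Gamma_int N.
     norm_loc_int \<Lambda> N (D - \<zeta>) + alpha_proj P * T_proj P D \<zeta> + alpha_harm P * T_harm P D \<zeta>)"

text \<open>The argument \<open>\<zeta>\<close> is the selected representative of \<open>D\<close>. Vector and tensor fields are measured
  with the pointwise Euclidean norm.\<close>

definition R_core ::
    "('x::real_vector, 'h) pressure_data \<Rightarrow> (int \<times> nat \<Rightarrow> 'x) \<Rightarrow> (int \<times> nat \<Rightarrow> 'x) \<Rightarrow> real" where
  "R_core P D \<zeta> =
     2 * C_eta P * (LpLp_norm 3 time_I (ball 0 1 - ball 0 (3/4)) (velocity P (D - \<zeta>)))\<^sup>2
     + C_Riesz P * LpLp_norm (3/2) time_I (ball 0 1) (M_act P (D - \<zeta>))"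

definition R_tail ::
    "'x::real_vector intrinsic_data \<Rightarrow> ('x, 'h::real_normed_vector) pressure_data
      \<Rightarrow> (int \<times> nat \<Rightarrow> 'x) \<Rightarrow> real" where
  "R_tail N P D = (INF \<zeta>\<in>Gamma_int N. T_proj P D \<zeta>) + (INF \<zeta>\<in>Gamma_int N. T_harm P D \<zeta>)"

end

theory Submission
  imports Defs
begin

text \<open>
  By homogeneity and gauge invariance, the detector dominates \<open>\<mu>\<close> times the distance to the clean
  gauge space. Averaging the three visibility bounds turns this distance into the tail
  distance \<open>\<rho>\<close>, and the residuals are absorbed at the selected representative; in particular, the
  two infima in the tail residual are bounded by their terms there, which \<open>\<rho>\<close> controls.
  All this needs \<open>\<mu> \<ge> 0\<close>, so the unit sphere over which \<open>\<mu>\<close> is an infimum must not be empty. It is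
  not, because the gauge space is finite-dimensional, hence closed.
\<close>

section \<open>Distance to a subspace\<close>

lemma normed_subspaceD:
  assumes "normed_subspace V n"
  shows "subspace V"
    and "x \<in> V \<Longrightarrow> 0 \<le> n x"
    and "x \<in> V \<Longrightarrow> n x = 0 \<longleftrightarrow> x = 0"
    and "x \<in> V \<Longrightarrow> n (c *\<^sub>R x) = \<bar>c\<bar> * n x"
    and "x \<in> V \<Longrightarrow> y \<in> V \<Longrightarrow> n (x + y) \<le> n x + n y"
  using assms unfolding normed_subspace_def by blast+

text \<open>Nonnegativity of \<open>n\<close> on \<open>V\<close> gives the lower bound that a real
  infimum needs to lie below its terms.\<close>

lemma INF_norm_diff_le:
  assumes n: "normed_subspace V n" and "W \<subseteq> V" "d \<in> V" "w \<in> W"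
  shows "(INF w\<in>W. n (d - w)) \<le> n (d - w)"
proof (rule cINF_lower)
  show "bdd_below ((\<lambda>w. n (d - w)) ` W)"
    using assms normed_subspaceD(1,2)[OF n] by (intro bdd_belowI[of _ 0]) (auto intro: subspace_diff)
qed fact

lemma INF_norm_diff_nonneg:
  assumes n: "normed_subspace V n" and "W \<subseteq> V" "d \<in> V" "W \<noteq> {}"
  shows "0 \<le> (INF w\<in>W. n (d - w))"
  using assms normed_subspaceD(1,2)[OF n] by (intro cINF_greatest) (auto intro: subspace_diff)

text \<open>Translation by \<open>g\<close> permutes \<open>W\<close>, so both infima range over the
  same values. Only one inequality is proved; the reverse is the same inequality at
  \<open>d + g\<close> and \<open>- g\<close>.\<close>

lemma INF_norm_diff_translate:
  assumes n: "normed_subspace V n" and W: "subspace W" "W \<subseteq> V" and d: "d \<in> V" and g: "g \<in> W"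
  shows "(INF w\<in>W. n (d + g - w)) = (INF w\<in>W. n (d - w))"
proof -
  have le: "(INF w\<in>W. n (d - w)) \<le> (INF w\<in>W. n (d + g - w))" if "d \<in> V" "g \<in> W" for d g
  proof (rule cINF_greatest)
    show "W \<noteq> {}" using that by auto
    fix w assume "w \<in> W"
    then have "w - g \<in> W" using W that by (auto intro: subspace_diff)
    from INF_norm_diff_le[OF n W(2) that(1) this]
    show "(INF w\<in>W. n (d - w)) \<le> n (d + g - w)" by (simp add: algebra_simps)
  qed
  have "d + g \<in> V" "- g \<in> W"
    using normed_subspaceD(1)[OF n] W d g by (auto intro: subspace_add subspace_neg)
  from le[OF this] le[OF d g] show ?thesis by simp
qed

text \<open>Nonzero scaling permutes \<open>W\<close>. Again one inequality suffices: applied to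
  \<open>c *\<^sub>R d\<close> with the factor \<open>inverse c\<close>, it yields the reverse
  one.\<close>

lemma INF_norm_diff_scaleR:
  assumes n: "normed_subspace V n" and W: "subspace W" "W \<subseteq> V" and d: "d \<in> V" and c: "c \<noteq> 0"
  shows "(INF w\<in>W. n (c *\<^sub>R d - w)) = \<bar>c\<bar> * (INF w\<in>W. n (d - w))"
proof -
  have le: "\<bar>c\<bar> * (INF w\<in>W. n (d - w)) \<le> (INF w\<in>W. n (c *\<^sub>R d - w))"
    if "d \<in> V" "c \<noteq> 0" for d and c :: real
  proof (rule cINF_greatest)
    show "W \<noteq> {}" using W(1) subspace_0 by blast
    fix w assume w: "w \<in> W"
    then have w': "inverse c *\<^sub>R w \<in> W" using W by (auto intro: subspace_scale)
    then have "d - inverse c *\<^sub>R w \<in> V"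
      using normed_subspaceD(1)[OF n] W that by (auto intro: subspace_diff)
    from normed_subspaceD(4)[OF n this, of c]
    have "n (c *\<^sub>R d - w) = \<bar>c\<bar> * n (d - inverse c *\<^sub>R w)"
      using that by (simp add: scaleR_diff_right)
    with INF_norm_diff_le[OF n W(2) that(1) w']
    show "\<bar>c\<bar> * (INF w\<in>W. n (d - w)) \<le> n (c *\<^sub>R d - w)" by (simp add: mult_left_mono)
  qed
  have "c *\<^sub>R d \<in> V" using normed_subspaceD(1)[OF n] d by (auto intro: subspace_scale)
  from le[OF this, of "inverse c"] c
  have "(INF w\<in>W. n (c *\<^sub>R d - w)) \<le> \<bar>c\<bar> * (INF w\<in>W. n (d - w))"
    by (simp add: field_simps)
  with le[OF d c] show ?thesis by simp
qed

text \<open>The triangle inequality, used for each \<open>w\<close> separately. It serves below both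
  for Lipschitz continuity along a line and for growth at infinity.\<close>

lemma INF_norm_diff_add_le:
  assumes n: "normed_subspace V n" and W: "W \<subseteq> V" "W \<noteq> {}" and d: "d \<in> V" and e: "e \<in> V"
  shows "(INF w\<in>W. n (d + e - w)) \<le> (INF w\<in>W. n (d - w)) + n e"
proof -
  have "(INF w\<in>W. n (d + e - w)) - n e \<le> (INF w\<in>W. n (d - w))"
  proof (rule cINF_greatest[OF W(2)])
    fix w assume w: "w \<in> W"
    then have "d - w \<in> V" "d + e \<in> V"
      using normed_subspaceD(1)[OF n] W d e by (auto intro: subspace_diff subspace_add)
    with INF_norm_diff_le[OF n W(1) this(2) w] normed_subspaceD(5)[OF n this(1) e]
    show "(INF w\<in>W. n (d + e - w)) - n e \<le> n (d - w)" by (simp add: algebra_simps)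
  qed
  then show ?thesis by simp
qed

text \<open>Induction on \<open>B\<close>: the distance of \<open>d - c *\<^sub>R b\<close> to \<open>span B\<close> is positive and Lipschitz in \<open>c\<close>,
  hence bounded below by a positive number on compact intervals, and it is large for large \<open>\<bar>c\<bar>\<close>.\<close>

lemma INF_norm_diff_span_pos:
  assumes n: "normed_subspace V n" and "finite B" "B \<subseteq> V" "d \<in> V" "d \<notin> span B"
  shows "0 < (INF w\<in>span B. n (d - w))"
  using assms(2-)
proof (induction B arbitrary: d rule: finite_induct)
  case empty
  then show ?case
    using normed_subspaceD(2,3)[OF n] by (force simp: less_le)
next
  case (insert b B)
  have V: "subspace V" by (rule normed_subspaceD(1)[OF n])
  have bV: "b \<in> V" and BV: "span B \<subseteq> V"
    using insert.prems V by (simp_all add: span_minimal)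
  have ne: "span B \<noteq> {}" using span_zero by blast
  show ?case
  proof (cases "b \<in> span B")
    case True
    then have "span (insert b B) = span B" by (rule span_redundant)
    with insert show ?thesis by simp
  next
    case False
    define \<epsilon> where "\<epsilon> = (INF w\<in>span B. n (b - w))"
    \<comment> \<open>The induction hypothesis at \<open>b\<close> itself; this distance controls
      the growth in \<open>c\<close>.\<close>
    have \<epsilon>: "\<epsilon> > 0" unfolding \<epsilon>_def using insert.IH[of b] insert.prems False by simp
    define f where "f c = (INF w\<in>span B. n (d - c *\<^sub>R b - w))" for c :: real
    \<comment> \<open>Beyond this radius \<open>\<bar>c\<bar> * \<epsilon>\<close> is at least
      \<open>n d + 1\<close>, which leaves at least 1 after \<open>n d\<close> is lost to the
      triangle inequality.\<close>
    define r where "r = (n d + 1) / \<epsilon>"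
    have dcV: "d - c *\<^sub>R b \<in> V" for c :: real
      using V bV insert.prems by (auto intro: subspace_diff subspace_scale)
    \<comment> \<open>If \<open>d - c *\<^sub>R b\<close> were in \<open>span B\<close>, then
      \<open>d\<close> would be in \<open>span (insert b B)\<close>.\<close>
    have f_pos: "f c > 0" for c
    proof -
      have "d - c *\<^sub>R b \<notin> span B"
        using insert.prems(3) span_breakdown_eq[of d b B] by blast
      with insert.IH[OF _ dcV] insert.prems show ?thesis unfolding f_def by simp
    qed
    have f_lip: "f c \<le> f c' + \<bar>c' - c\<bar> * n b" for c c'
    proof -
      have "(c' - c) *\<^sub>R b \<in> V" using V bV by (auto intro: subspace_scale)
      from INF_norm_diff_add_le[OF n BV ne dcV[of c'] this] normed_subspaceD(4)[OF n bV, of "c' - c"]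
      show ?thesis unfolding f_def by (simp add: algebra_simps)
    qed
    have "(n b)-lipschitz_on UNIV f"
    proof (rule lipschitz_onI)
      show "0 \<le> n b" using normed_subspaceD(2)[OF n bV] .
      show "dist (f c) (f c') \<le> n b * dist c c'" for c c'
        using f_lip[of c c'] f_lip[of c' c]
        by (simp add: dist_real_def abs_le_iff algebra_simps abs_minus_commute)
    qed
    then have cont: "continuous_on {-\<bar>r\<bar>..\<bar>r\<bar>} f"
      by (meson continuous_on_subset lipschitz_on_continuous_on subset_UNIV)
    obtain m where m: "\<And>c. c \<in> {-\<bar>r\<bar>..\<bar>r\<bar>} \<Longrightarrow> f m \<le> f c"
      using continuous_attains_inf[OF compact_Icc _ cont] by force
    \<comment> \<open>Each \<open>w\<close> is some \<open>c *\<^sub>R b\<close> plus an element of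
      \<open>span B\<close>. The minimum \<open>f m\<close> handles \<open>c\<close> inside the
      interval, and the constant 1 handles \<open>c\<close> outside.\<close>
    have "min 1 (f m) \<le> (INF w\<in>span (insert b B). n (d - w))"
    proof (rule cINF_greatest)
      show "span (insert b B) \<noteq> {}" using span_zero by blast
      fix w assume "w \<in> span (insert b B)"
      then obtain c where c: "w - c *\<^sub>R b \<in> span B" using span_breakdown_eq by blast
      have le: "f c \<le> n (d - w)"
        using INF_norm_diff_le[OF n BV dcV[of c] c] unfolding f_def by (simp add: algebra_simps)
      show "min 1 (f m) \<le> n (d - w)"
      proof (cases "\<bar>c\<bar> \<le> \<bar>r\<bar>")
        case True
        with m[of c] le show ?thesis by (simp add: abs_le_iff min_def)
      next
        case False
        then have "c \<noteq> 0" by auto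
        have dV: "d \<in> V" and cbV: "(- c) *\<^sub>R b \<in> V" and mdV: "(-1) *\<^sub>R d \<in> V"
          using V bV insert.prems by (auto intro: subspace_scale subspace_neg)
        have "r \<ge> 0" unfolding r_def using \<epsilon> normed_subspaceD(2)[OF n dV] by simp
        \<comment> \<open>The vector \<open>(-c) *\<^sub>R b\<close> is the sum of
          \<open>d - c *\<^sub>R b\<close> and \<open>- d\<close>, so its distance to
          \<open>span B\<close> is at most \<open>f c + n d\<close>.\<close>
        have "\<bar>-c\<bar> * \<epsilon> = (INF w\<in>span B. n ((-c) *\<^sub>R b - w))"
          unfolding \<epsilon>_def using INF_norm_diff_scaleR[OF n subspace_span BV bV, of "-c"] \<open>c \<noteq> 0\<close> by simp
        also have "\<dots> \<le> f c + n d"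
          using INF_norm_diff_add_le[OF n BV ne dcV[of c] mdV] normed_subspaceD(4)[OF n dV, of "-1"]
          unfolding f_def by simp
        finally have "\<bar>c\<bar> * \<epsilon> \<le> n (d - w) + n d" using le by simp
        moreover have "n d + 1 \<le> \<bar>c\<bar> * \<epsilon>"
          using False \<epsilon> \<open>r \<ge> 0\<close> by (simp add: r_def field_simps)
        ultimately show ?thesis by simp
      qed
    qed
    with f_pos[of m] show ?thesis by linarith
  qed
qed

text \<open>A maximal independent subset of \<open>W\<close> spans it, and independence inside the
  span of the finite set \<open>T\<close> forces it to be finite.\<close>

lemma subspace_of_span_finite:
  fixes W :: "'a::real_vector set"
  assumes "subspace W" "W \<subseteq> span T" "finite T"
  obtains B where "finite B" "B \<subseteq> W" "span B = W"
proof -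
  obtain B where B: "B \<subseteq> W" "independent B" "W \<subseteq> span B"
    using maximal_independent_subset[of W] by metis
  then have "finite B" using independent_span_bound[OF assms(3), of B] assms(2) by blast
  moreover have "span B = W" using B assms(1) span_minimal by blast
  ultimately show ?thesis using B(1) that by blast
qed

section \<open>The clean detector\<close>

lemma Gamma_cl_subspace:
  assumes C: "clean_setting C"
  shows "subspace (Gamma_cl C)"
proof -
  have "subspace (K_cl C)" and G: "linear_between UNIV (D_cl_prod C) (G_cl C)"
    using C by (auto simp: clean_setting_def)
  moreover have "linear (G_cl C)"
    using G by (intro linearI) (auto simp: linear_between_def)
  ultimately show ?thesis
    unfolding Gamma_cl_def by (intro subspace_inter linear_subspace_image subspace_UNIV)
qed

text \<open>The gauge space lies in the image of \<open>G_cl C\<close>, which is spanned by the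
  images of finitely many vectors spanning the domain.\<close>

lemma Gamma_cl_finite_span:
  fixes C :: "('d::real_vector, 'c::real_normed_vector, 'o::real_vector) clean_data"
  assumes C: "clean_setting C"
  obtains B where "finite B" "B \<subseteq> Gamma_cl C" "span B = Gamma_cl C"
proof -
  have G: "linear_between UNIV (D_cl_prod C) (G_cl C)" and "fin_dim (UNIV :: 'c set)"
    using C by (auto simp: clean_setting_def)
  then obtain T :: "'c set" where T: "finite T" "span T = UNIV" unfolding fin_dim_def by metis
  have lin: "linear (G_cl C)"
    using G by (intro linearI) (auto simp: linear_between_def)
  have "Gamma_cl C \<subseteq> span (G_cl C ` T)"
    using T(2) by (simp add: linear_span_image[OF lin] Gamma_cl_def)
  with subspace_of_span_finite[OF Gamma_cl_subspace[OF C]] T(1) that show ?thesis by blast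
qed

text \<open>This lets the distance lemmas be applied with \<open>K_cl C\<close> as the ambient space
  and \<open>Gamma_cl C\<close> as the subspace.\<close>

lemma K_cl_normed:
  assumes C: "clean_setting C"
  shows "normed_subspace (K_cl C) (norm_cl C)"
  using assms unfolding clean_setting_def normed_subspace_def by (meson subsetD)

lemma Gamma_cl_subset_K_cl: "Gamma_cl C \<subseteq> K_cl C"
  by (auto simp: Gamma_cl_def)

lemma dist_cl_nonneg:
  assumes "clean_setting C" "d \<in> K_cl C"
  shows "0 \<le> dist_cl C d"
  unfolding dist_cl_def
  using INF_norm_diff_nonneg[OF K_cl_normed Gamma_cl_subset_K_cl] assms
    subspace_0[OF Gamma_cl_subspace] by blast

lemma dist_cl_translate:
  assumes "clean_setting C" "d \<in> K_cl C" "\<gamma> \<in> Gamma_cl C"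
  shows "dist_cl C (d + \<gamma>) = dist_cl C d"
  unfolding dist_cl_def
  using INF_norm_diff_translate[OF K_cl_normed Gamma_cl_subspace Gamma_cl_subset_K_cl] assms by blast

lemma dist_cl_scaleR:
  assumes "clean_setting C" "d \<in> K_cl C" "c \<noteq> 0"
  shows "dist_cl C (c *\<^sub>R d) = \<bar>c\<bar> * dist_cl C d"
  unfolding dist_cl_def
  using INF_norm_diff_scaleR[OF K_cl_normed Gamma_cl_subspace Gamma_cl_subset_K_cl] assms by blast

text \<open>Finite dimension of the gauge space enters here: it makes the quotient seminorm a
  norm.\<close>

lemma dist_cl_pos:
  assumes "clean_setting C" "d \<in> K_cl C" "d \<notin> Gamma_cl C"
  shows "0 < dist_cl C d"
proof -
  obtain B where B: "finite B" "B \<subseteq> Gamma_cl C" "span B = Gamma_cl C"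
    using Gamma_cl_finite_span[OF assms(1)] .
  have "B \<subseteq> K_cl C" using B(2) Gamma_cl_subset_K_cl by blast
  from INF_norm_diff_span_pos[OF K_cl_normed[OF assms(1)] B(1) this assms(2)] assms(3) B(3)
  show ?thesis by (simp add: dist_cl_def)
qed

section \<open>Sign and homogeneity of the detector\<close>

lemma M_comp_nonneg:
  assumes C: "clean_setting C" and d: "d \<in> K_cl C"
  shows "0 \<le> M_comp C d"
proof -
  have "linear_between (K_cl C) (Obs_prod C) (O_cl C)"
    using C unfolding clean_setting_def by blast
  then have "O_cl C d \<in> Obs_prod C" using d by (auto simp: linear_between_def)
  moreover have "normed_subspace (Obs_prod C) (norm_Obs C)"
    using C unfolding clean_setting_def by blast
  ultimately have "0 \<le> norm_Obs C (O_cl C d)" by (rule normed_subspaceD(2)[rotated])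
  moreover have "0 \<le> Tax_cl C d" "0 < const_R C" "0 < const_T C"
    using C d unfolding clean_setting_def by blast+
  moreover have "0 \<le> Rep_cl C d" unfolding Rep_cl_def by (simp add: sum_nonneg)
  ultimately show ?thesis unfolding M_comp_def by simp
qed

text \<open>Each residual between adjacent scales is linear in \<open>d\<close>, so its norm scales
  by \<open>\<bar>c\<bar>\<close>; the common factor then leaves the root of the sum of
  squares.\<close>

lemma Rep_cl_scaleR:
  assumes C: "clean_setting C" and d: "d \<in> D_cl_prod C"
  shows "Rep_cl C (c *\<^sub>R d) = \<bar>c\<bar> * Rep_cl C d"
proof -
  have "norm_D_cl C (k + 1) ((c *\<^sub>R d) (k + 1) - R_cl C k ((c *\<^sub>R d) k))
      = \<bar>c\<bar> * norm_D_cl C (k + 1) (d (k + 1) - R_cl C k (d k))" if k: "k \<in> scales_adj C" for k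
  proof -
    have k': "k \<in> scales C" "k + 1 \<in> scales C" using k by (auto simp: scales_adj_def)
    have n: "normed_subspace (D_cl C (k + 1)) (norm_D_cl C (k + 1))"
      and R: "linear_between (D_cl C k) (D_cl C (k + 1)) (R_cl C k)"
      using C k k' unfolding clean_setting_def by blast+
    have dk: "d k \<in> D_cl C k" "d (k + 1) \<in> D_cl C (k + 1)"
      using d k' by (auto simp: D_cl_prod_def prod_space_def)
    then have "d (k + 1) - R_cl C k (d k) \<in> D_cl C (k + 1)"
      using R normed_subspaceD(1)[OF n] by (auto simp: linear_between_def intro!: subspace_diff)
    from normed_subspaceD(4)[OF n this, of c] show ?thesis
      using R dk(1) by (simp add: linear_between_def scaleR_fun_def scaleR_diff_right)
  qed
  then show ?thesis
    by (simp add: Rep_cl_def power_mult_distrib real_sqrt_mult flip: sum_distrib_left)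
qed

lemma M_comp_scaleR:
  assumes C: "clean_setting C" and d: "d \<in> K_cl C"
  shows "M_comp C (c *\<^sub>R d) = \<bar>c\<bar> * M_comp C d"
proof -
  have O: "linear_between (K_cl C) (Obs_prod C) (O_cl C)"
    and n: "normed_subspace (Obs_prod C) (norm_Obs C)"
    and Tax: "Tax_cl C (c *\<^sub>R d) = \<bar>c\<bar> * Tax_cl C d"
    and D: "d \<in> D_cl_prod C"
    using C d unfolding clean_setting_def by blast+
  have "O_cl C (c *\<^sub>R d) = c *\<^sub>R O_cl C d" "O_cl C d \<in> Obs_prod C"
    using O d by (auto simp: linear_between_def)
  with Tax normed_subspaceD(4)[OF n] Rep_cl_scaleR[OF C D] show ?thesis
    by (simp add: M_comp_def algebra_simps)
qed

section \<open>Cosets, the unit sphere and the constant \<mu>\<close>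

lemma gauge_rel_Image:
  assumes "clean_setting C" "d \<in> K_cl C"
  shows "gauge_rel C `` {d} = (\<lambda>\<gamma>. d + \<gamma>) ` Gamma_cl C"
proof (intro equalityI subsetI)
  fix e assume "e \<in> gauge_rel C `` {d}"
  then have "- (d - e) \<in> Gamma_cl C"
    using subspace_neg[OF Gamma_cl_subspace[OF assms(1)]] by (auto simp only: gauge_rel_def)
  then show "e \<in> (\<lambda>\<gamma>. d + \<gamma>) ` Gamma_cl C" by (intro image_eqI[of _ _ "- (d - e)"]) auto
next
  fix e assume "e \<in> (\<lambda>\<gamma>. d + \<gamma>) ` Gamma_cl C"
  then obtain \<gamma> where "e = d + \<gamma>" "\<gamma> \<in> Gamma_cl C" by blast
  moreover have "- \<gamma> \<in> Gamma_cl C" "d + \<gamma> \<in> K_cl C"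
    using calculation assms Gamma_cl_subset_K_cl[of C] subspace_neg[OF Gamma_cl_subspace[OF assms(1)]]
      subspace_add[OF normed_subspaceD(1)[OF K_cl_normed[OF assms(1)]]] by blast+
  ultimately show "e \<in> gauge_rel C `` {d}" using assms by (simp add: gauge_rel_def)
qed

text \<open>Invariance collapses the image of the coset to a singleton, so \<open>the_elem\<close>
  returns the value at any chosen representative.\<close>

lemma the_elem_image_coset:
  assumes C: "clean_setting C" and d: "d \<in> K_cl C"
    and inv: "\<And>\<gamma>. \<gamma> \<in> Gamma_cl C \<Longrightarrow> f (d + \<gamma>) = f d"
  shows "the_elem (f ` (gauge_rel C `` {d})) = f d"
proof -
  have "0 \<in> Gamma_cl C" by (rule subspace_0[OF Gamma_cl_subspace[OF C]])
  then have "f ` (gauge_rel C `` {d}) = {f d}"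
    unfolding gauge_rel_Image[OF C d] using inv by (auto simp: image_image)
  then show ?thesis by simp
qed

lemma M_comp_bar_coset:
  assumes "clean_setting C" "gauge_compatible C" "d \<in> K_cl C"
  shows "M_comp_bar C (gauge_rel C `` {d}) = M_comp C d"
  unfolding M_comp_bar_def using assms
  by (intro the_elem_image_coset) (auto simp: gauge_compatible_def M_comp_def)

lemma normalized_coset_in_S_cl:
  assumes C: "clean_setting C" and d: "d \<in> K_cl C" and pos: "0 < dist_cl C d"
  shows "gauge_rel C `` {inverse (dist_cl C d) *\<^sub>R d} \<in> S_cl C"
proof -
  let ?e = "inverse (dist_cl C d) *\<^sub>R d"
  have e: "?e \<in> K_cl C" using C d by (auto simp: clean_setting_def intro: subspace_scale)
  have "Q_cl_norm C (gauge_rel C `` {?e}) = dist_cl C ?e"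
    unfolding Q_cl_norm_def by (rule the_elem_image_coset[OF C e dist_cl_translate[OF C e]])
  also have "\<dots> = 1" using dist_cl_scaleR[OF C d, of "inverse (dist_cl C d)"] pos by simp
  finally show ?thesis unfolding S_cl_def Q_cl_def using e by (auto intro: quotientI)
qed

text \<open>A nonzero coset has a representative outside the gauge space, hence at positive distance
  from it, and this representative can be normalized.\<close>

lemma S_cl_nonempty:
  assumes C: "clean_setting C" and "Q_cl C \<noteq> {Q_cl_zero C}"
  shows "S_cl C \<noteq> {}"
proof -
  have \<Gamma>: "subspace (Gamma_cl C)" by (rule Gamma_cl_subspace[OF C])
  have K0: "0 \<in> K_cl C" using \<Gamma> subspace_0 Gamma_cl_subset_K_cl by blast
  then have "Q_cl_zero C \<in> Q_cl C" unfolding Q_cl_def Q_cl_zero_def by (rule quotientI)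
  with assms(2) obtain q where "q \<in> Q_cl C" "q \<noteq> Q_cl_zero C" by blast
  then obtain d where d: "d \<in> K_cl C" "gauge_rel C `` {d} \<noteq> gauge_rel C `` {0}"
    unfolding Q_cl_def Q_cl_zero_def by (blast elim: quotientE)
  have "d \<notin> Gamma_cl C"
  proof
    assume dG: "d \<in> Gamma_cl C"
    have "(\<lambda>\<gamma>. d + \<gamma>) ` Gamma_cl C = (\<lambda>\<gamma>. 0 + \<gamma>) ` Gamma_cl C"
    proof (intro equalityI subsetI)
      fix e assume "e \<in> (\<lambda>\<gamma>. 0 + \<gamma>) ` Gamma_cl C"
      then have "e - d \<in> Gamma_cl C" using \<Gamma> dG by (auto intro: subspace_diff)
      then show "e \<in> (\<lambda>\<gamma>. d + \<gamma>) ` Gamma_cl C" by (intro image_eqI[of _ _ "e - d"]) auto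
    qed (use \<Gamma> dG in \<open>auto intro: subspace_add\<close>)
    with d(2) show False unfolding gauge_rel_Image[OF C d(1)] gauge_rel_Image[OF C K0] by simp
  qed
  from normalized_coset_in_S_cl[OF C d(1) dist_cl_pos[OF C d(1) this]] show ?thesis by blast
qed

lemma M_comp_bar_nonneg:
  assumes "clean_setting C" "gauge_compatible C" "q \<in> S_cl C"
  shows "0 \<le> M_comp_bar C q"
proof -
  obtain d where "d \<in> K_cl C" "q = gauge_rel C `` {d}"
    using assms(3) by (auto simp: S_cl_def Q_cl_def elim: quotientE)
  then show ?thesis using M_comp_bar_coset M_comp_nonneg assms by metis
qed

lemma mu_comp_nonneg:
  assumes "clean_setting C" "gauge_compatible C" "Q_cl C \<noteq> {Q_cl_zero C}"
  shows "0 \<le> mu_comp C"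
  unfolding mu_comp_def using assms S_cl_nonempty M_comp_bar_nonneg by (intro cINF_greatest) auto

lemma M_comp_ge_mu_dist:
  assumes C: "clean_setting C" and gauge: "gauge_compatible C" and d: "d \<in> K_cl C"
  shows "mu_comp C * dist_cl C d \<le> M_comp C d"
proof (cases "dist_cl C d = 0")
  \<comment> \<open>At distance zero no normalization is possible, but the claim reduces to
    nonnegativity of the detector.\<close>
  case True
  then show ?thesis using M_comp_nonneg[OF C d] by simp
next
  case False
  then have pos: "0 < dist_cl C d" using dist_cl_nonneg[OF C d] by simp
  let ?e = "inverse (dist_cl C d) *\<^sub>R d"
  have e: "?e \<in> K_cl C" using C d by (auto simp: clean_setting_def intro: subspace_scale)
  have "mu_comp C \<le> M_comp_bar C (gauge_rel C `` {?e})"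
    unfolding mu_comp_def using normalized_coset_in_S_cl[OF C d pos] M_comp_bar_nonneg[OF C gauge]
    by (intro cINF_lower bdd_belowI[of _ 0]) auto
  also have "\<dots> = inverse (dist_cl C d) * M_comp C d"
    using M_comp_bar_coset[OF C gauge e] M_comp_scaleR[OF C d] pos by simp
  finally show ?thesis using pos by (simp add: field_simps)
qed

section \<open>Tail functionals\<close>

text \<open>A real \<open>powr\<close> is never negative, so \<open>f\<close> may be arbitrary, even
  non-measurable.\<close>

lemma LpLp_norm_nonneg: "0 \<le> LpLp_norm p T S f"
  by (simp add: LpLp_norm_def Lp_norm_def)

text \<open>A real supremum dominates its terms only when they are bounded above. Boundedness of
  \<open>T\<close> supplies this, and the term at \<open>z\<close> then gives the sign.\<close>

lemma op_norm_nonneg: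
  assumes bound: "\<And>v. v \<in> V \<Longrightarrow> nW (T v) \<le> c * nV v"
    and "\<And>v. 0 \<le> nV v" "\<And>w. 0 \<le> nW w" "z \<in> V" "nV z \<le> 1"
  shows "0 \<le> op_norm V nV nW T"
proof -
  \<comment> \<open>The bound \<open>c\<close> comes without a sign, hence the absolute
    value.\<close>
  have "nW (T v) \<le> \<bar>c\<bar>" if "v \<in> V" "nV v \<le> 1" for v
  proof -
    have "nW (T v) \<le> \<bar>c\<bar> * nV v"
      using bound[OF that(1)] assms(2)[of v] by (meson abs_ge_self mult_right_mono order_trans)
    also have "\<dots> \<le> \<bar>c\<bar> * 1" using that by (intro mult_left_mono) auto
    finally show ?thesis by simp
  qed
  then have "bdd_above ((\<lambda>v. nW (T v)) ` {v \<in> V. nV v \<le> 1})" by (intro bdd_aboveI) auto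
  then have "nW (T z) \<le> op_norm V nV nW T" unfolding op_norm_def using assms by (intro cSUP_upper) auto
  with assms(3)[of "T z"] show ?thesis by linarith
qed

lemma T_proj_nonneg:
  assumes P: "pressure_setting pk P"
  shows "0 \<le> T_proj P D \<zeta>"
proof -
  have "\<exists>c. \<forall>f\<in>Y_prs. Y_prs_norm (P_prs P f) \<le> c * Y_prs_norm f"
    using P by (simp add: pressure_setting_def)
  then obtain c where c: "\<And>f. f \<in> Y_prs \<Longrightarrow> Y_prs_norm (P_prs P f) \<le> c * Y_prs_norm f"
    by blast
  \<comment> \<open>The zero function serves as the element of the unit ball at which the supremum
    is tested.\<close>
  have "(\<lambda>t x. 0) \<in> Y_prs" "Y_prs_norm (\<lambda>t x. 0) \<le> 1"
    by (simp_all add: LpLp_space_def Lp_space_def LpLp_norm_def Lp_norm_def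
        set_borel_measurable_def set_integrable_def case_prod_unfold)
  then have "0 \<le> op_norm Y_prs Y_prs_norm Y_prs_norm (P_prs P)"
    using op_norm_nonneg[where V = Y_prs and nV = Y_prs_norm and nW = Y_prs_norm
        and T = "P_prs P" and c = c and z = "\<lambda>t x. 0"] c LpLp_norm_nonneg by metis
  then show ?thesis by (simp add: T_proj_def LpLp_norm_nonneg)
qed

lemma T_harm_nonneg:
  assumes P: "pressure_setting pk P"
  shows "0 \<le> T_harm P D \<zeta>"
proof -
  have "\<exists>c. \<forall>h. Y_prs_norm (J_harm P h) \<le> c * norm h"
    using P by (simp add: pressure_setting_def)
  then obtain c where c: "\<And>h. Y_prs_norm (J_harm P h) \<le> c * norm h"
    by blast
  have "0 \<le> op_norm UNIV norm Y_prs_norm (J_harm P)"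
    by (rule op_norm_nonneg[where c = c and z = 0]) (simp_all add: c LpLp_norm_nonneg)
  then show ?thesis by (simp add: T_harm_def)
qed

lemma norm_loc_int_nonneg:
  assumes "intrinsic_setting \<Lambda> N"
  shows "0 \<le> norm_loc_int \<Lambda> N D"
proof -
  have "0 \<le> weight N j" if "j \<in> {1..7}" for j
    using assms that by (simp add: intrinsic_setting_def less_imp_le)
  then show ?thesis
    unfolding norm_loc_int_def by (intro real_sqrt_ge_zero sum_nonneg mult_nonneg_nonneg) auto
qed

text \<open>Both infima are bounded below by 0, so each lies below its term at the same
  \<open>\<zeta>\<close>, although they are taken independently.\<close>

lemma R_tail_le:
  assumes "pressure_setting pk P" "\<zeta> \<in> Gamma_int N"
  shows "R_tail N P D \<le> T_proj P D \<zeta> + T_harm P D \<zeta>"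
  unfolding R_tail_def using assms T_proj_nonneg T_harm_nonneg
  by (intro add_mono cINF_lower bdd_belowI[of _ 0]) auto

text \<open>The factor 1/3 comes from averaging three lower bounds for one distance; the cap at 1
  only weakens the estimate.\<close>

lemma min_third_mult_sum_le:
  fixes a b c x y z :: real
  assumes "0 \<le> x" "0 \<le> y" "0 \<le> z"
  shows "min 1 (1/3 * min a (min b c)) * (x + y + z) \<le> 1/3 * (a * x + b * y + c * z)"
proof -
  let ?m = "min a (min b c)"
  have "min 1 (1/3 * ?m) * (x + y + z) \<le> 1/3 * ?m * (x + y + z)"
    using assms by (intro mult_right_mono) auto
  also have "\<dots> = 1/3 * (?m * x + ?m * y + ?m * z)" by (simp add: algebra_simps)
  also have "\<dots> \<le> 1/3 * (a * x + b * y + c * z)"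
    using assms by (intro mult_left_mono add_mono mult_right_mono) auto
  finally show ?thesis .
qed

text \<open>Undoing the weights costs at most the larger inverse weight. This is the source of the
  \<open>max\<close> term in the decay constant for the tail residual.\<close>

lemma sum_le_max_inverse_mult:
  fixes a b x y :: real
  assumes "0 < a" "0 < b" "0 \<le> x" "0 \<le> y"
  shows "x + y \<le> max (inverse a) (inverse b) * (a * x + b * y)"
proof -
  let ?m = "max (inverse a) (inverse b)"
  have "inverse a * (a * x) + inverse b * (b * y) \<le> ?m * (a * x) + ?m * (b * y)"
    using assms by (intro add_mono mult_right_mono) auto
  moreover have "inverse a * (a * x) = x" "inverse b * (b * y) = y"
    using assms by (simp_all add: field_simps)
  ultimately show ?thesis by (simp add: distrib_left)
qed

section \<open>Combination of the visibility and residual bounds\<close>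

theorem corollary9p99:
  fixes C :: "('d::real_vector, 'c::real_normed_vector, 'o::real_vector) clean_data"
    and N :: "'x::real_vector intrinsic_data"
    and P :: "('x, 'h::real_normed_vector) pressure_data"
    and \<Theta> :: "(int \<times> nat \<Rightarrow> 'x) \<Rightarrow> (int \<Rightarrow> 'd)"
    and M_loc R_chart R_loc R_rep R_gate :: "(int \<times> nat \<Rightarrow> 'x) \<Rightarrow> real"
    and \<zeta>s :: "(int \<times> nat \<Rightarrow> 'x) \<Rightarrow> (int \<times> nat \<Rightarrow> 'x)"
    and \<kappa>0 \<kappa>_proj \<kappa>_harm \<delta>0 \<delta>_proj \<delta>_harm :: real
    and \<eta>_core \<eta>_chart \<eta>_loc \<eta>_rep \<eta>_gate :: real
    and \<Delta>_core \<Delta>_chart \<Delta>_loc \<Delta>_rep \<Delta>_gate :: real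
  assumes "clean_setting C"
    and "intrinsic_setting (scales C) N"
    and "pressure_setting (packages (scales C) N) P"
    and "\<forall>D\<in>packages (scales C) N. \<Theta> D \<in> K_cl C"
    and "\<forall>D\<in>packages (scales C) N.
           0 \<le> M_loc D \<and> 0 \<le> R_chart D \<and> 0 \<le> R_loc D \<and> 0 \<le> R_rep D \<and> 0 \<le> R_gate D"
    and "Q_cl C \<noteq> {Q_cl_zero C}"
    and "gauge_compatible C"
    and "kernel_free C"
    and "\<forall>D\<in>packages (scales C) N. \<zeta>s D \<in> Gamma_int N"
    \<comment> \<open>chart visibility\<close>
    and "\<kappa>0 > 0" "\<kappa>_proj > 0" "\<kappa>_harm > 0"
    and "\<delta>0 \<ge> 0" "\<delta>_proj \<ge> 0" "\<delta>_harm \<ge> 0"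
    and "\<forall>D\<in>packages (scales C) N.
           dist_cl C (\<Theta> D) \<ge> \<kappa>0 * norm_loc_int (scales C) N (D - \<zeta>s D) - \<delta>0
         \<and> dist_cl C (\<Theta> D) \<ge> \<kappa>_proj * alpha_proj P * T_proj P D (\<zeta>s D) - \<delta>_proj
         \<and> dist_cl C (\<Theta> D) \<ge> \<kappa>_harm * alpha_harm P * T_harm P D (\<zeta>s D) - \<delta>_harm"
    \<comment> \<open>same-gauge compatibility\<close>
    and "\<eta>_core \<ge> 0" "\<Delta>_core \<ge> 0"
    and "\<forall>D\<in>packages (scales C) N.
           dist_tail (scales C) N P D
             = norm_loc_int (scales C) N (D - \<zeta>s D)
               + alpha_proj P * T_proj P D (\<zeta>s D) + alpha_harm P * T_harm P D (\<zeta>s D)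
         \<and> R_core P D (\<zeta>s D) \<le> \<eta>_core * dist_tail (scales C) N P D + \<Delta>_core"
    \<comment> \<open>detector and residual sub-budgets\<close>
    and "\<forall>D\<in>packages (scales C) N.
           M_loc D + (R_core P D (\<zeta>s D) + R_tail N P D + R_chart D + R_loc D + R_rep D + R_gate D)
             \<ge> M_comp C (\<Theta> D)"
    and "\<eta>_chart \<ge> 0" "\<eta>_loc \<ge> 0" "\<eta>_rep \<ge> 0" "\<eta>_gate \<ge> 0"
    and "\<Delta>_chart \<ge> 0" "\<Delta>_loc \<ge> 0" "\<Delta>_rep \<ge> 0" "\<Delta>_gate \<ge> 0"
    and "\<forall>D\<in>packages (scales C) N.
           R_chart D \<le> \<eta>_chart * dist_tail (scales C) N P D + \<Delta>_chart
         \<and> R_loc D \<le> \<eta>_loc * dist_tail (scales C) N P D + \<Delta>_loc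
         \<and> R_rep D \<le> \<eta>_rep * dist_tail (scales C) N P D + \<Delta>_rep
         \<and> R_gate D \<le> \<eta>_gate * dist_tail (scales C) N P D + \<Delta>_gate"
  shows "let lam_G = min 1 (1/3 * min \<kappa>0 (min \<kappa>_proj \<kappa>_harm));
             \<delta>_G_vis = 1/3 * (\<delta>0 + \<delta>_proj + \<delta>_harm);
             \<eta>_dec = \<eta>_core + max (inverse (alpha_proj P)) (inverse (alpha_harm P))
                       + \<eta>_chart + \<eta>_loc + \<eta>_rep + \<eta>_gate;
             \<Delta>_dec = \<Delta>_core + \<Delta>_chart + \<Delta>_loc + \<Delta>_rep + \<Delta>_gate
         in \<forall>D\<in>packages (scales C) N.
              M_loc D \<ge> (mu_comp C * lam_G - \<eta>_dec) * dist_tail (scales C) N P D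
                          - mu_comp C * \<delta>_G_vis - \<Delta>_dec"
proof -
  note clean = assms(1) and intr = assms(2) and press = assms(3)
  define lam where "lam = min 1 (1/3 * min \<kappa>0 (min \<kappa>_proj \<kappa>_harm))"
  define m where "m = max (inverse (alpha_proj P)) (inverse (alpha_harm P))"
  have \<alpha>: "0 < alpha_proj P" "0 < alpha_harm P" using press by (auto simp: pressure_setting_def)
  have "M_loc D \<ge> (mu_comp C * lam - (\<eta>_core + m + \<eta>_chart + \<eta>_loc + \<eta>_rep + \<eta>_gate))
            * dist_tail (scales C) N P D
          - mu_comp C * (1/3 * (\<delta>0 + \<delta>_proj + \<delta>_harm))
          - (\<Delta>_core + \<Delta>_chart + \<Delta>_loc + \<Delta>_rep + \<Delta>_gate)"
    if D: "D \<in> packages (scales C) N" for D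
  proof -
    define \<rho> where "\<rho> = dist_tail (scales C) N P D"
    define x where "x = norm_loc_int (scales C) N (D - \<zeta>s D)"
    define y where "y = T_proj P D (\<zeta>s D)"
    define z where "z = T_harm P D (\<zeta>s D)"
    define \<delta> where "\<delta> = dist_cl C (\<Theta> D)"
    have nonneg: "0 \<le> x" "0 \<le> y" "0 \<le> z"
      using norm_loc_int_nonneg[OF intr] T_proj_nonneg[OF press] T_harm_nonneg[OF press]
      by (auto simp: x_def y_def z_def)
    have \<Theta>: "\<Theta> D \<in> K_cl C" and \<zeta>: "\<zeta>s D \<in> Gamma_int N" using assms(4,9) D by auto
    have vis: "\<kappa>0 * x - \<delta>0 \<le> \<delta>" "\<kappa>_proj * alpha_proj P * y - \<delta>_proj \<le> \<delta>"
        "\<kappa>_harm * alpha_harm P * z - \<delta>_harm \<le> \<delta>"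
      using assms(16) D by (auto simp: x_def y_def z_def \<delta>_def)
    have \<rho>: "\<rho> = x + alpha_proj P * y + alpha_harm P * z"
      and core: "R_core P D (\<zeta>s D) \<le> \<eta>_core * \<rho> + \<Delta>_core"
      using assms(19) D by (auto simp: x_def y_def z_def \<rho>_def)
    have det: "M_comp C (\<Theta> D) \<le> M_loc D
        + (R_core P D (\<zeta>s D) + R_tail N P D + R_chart D + R_loc D + R_rep D + R_gate D)"
      using assms(20) D by blast
    have res: "R_chart D \<le> \<eta>_chart * \<rho> + \<Delta>_chart" "R_loc D \<le> \<eta>_loc * \<rho> + \<Delta>_loc"
        "R_rep D \<le> \<eta>_rep * \<rho> + \<Delta>_rep" "R_gate D \<le> \<eta>_gate * \<rho> + \<Delta>_gate"
      using assms(29) D by (auto simp: \<rho>_def)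
    \<comment> \<open>The lemma is applied to the weighted terms, whose sum is \<open>\<rho>\<close>
      by same-gauge compatibility; the three visibility bounds are then averaged.\<close>
    have "lam * \<rho> \<le> 1/3 * (\<kappa>0 * x + \<kappa>_proj * (alpha_proj P * y) + \<kappa>_harm * (alpha_harm P * z))"
      unfolding lam_def \<rho> using nonneg \<alpha> by (intro min_third_mult_sum_le) auto
    also have "\<dots> \<le> 1/3 * ((\<delta> + \<delta>0) + (\<delta> + \<delta>_proj) + (\<delta> + \<delta>_harm))"
      using vis by (intro mult_left_mono add_mono) (simp_all add: mult.assoc)
    finally have "lam * \<rho> - 1/3 * (\<delta>0 + \<delta>_proj + \<delta>_harm) \<le> \<delta>" by (simp add: field_simps)
    \<comment> \<open>Multiplying by \<open>mu_comp C\<close> keeps the inequality because the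
      infimum over the nonempty sphere is nonnegative.\<close>
    then have "mu_comp C * (lam * \<rho> - 1/3 * (\<delta>0 + \<delta>_proj + \<delta>_harm)) \<le> mu_comp C * \<delta>"
      using mu_comp_nonneg[OF clean assms(7,6)] by (rule mult_left_mono)
    also have "\<dots> \<le> M_comp C (\<Theta> D)"
      unfolding \<delta>_def by (rule M_comp_ge_mu_dist[OF clean assms(7) \<Theta>])
    finally have vis_det: "mu_comp C * (lam * \<rho> - 1/3 * (\<delta>0 + \<delta>_proj + \<delta>_harm)) \<le> M_comp C (\<Theta> D)" .
    have "R_tail N P D \<le> y + z" unfolding y_def z_def by (rule R_tail_le[OF press \<zeta>])
    also have "\<dots> \<le> m * (alpha_proj P * y + alpha_harm P * z)"
      unfolding m_def using nonneg \<alpha> by (intro sum_le_max_inverse_mult)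
    \<comment> \<open>Adding the nonnegative term \<open>x\<close> completes the sum to
      \<open>\<rho>\<close>, and \<open>m\<close> is nonnegative since both weights are
      positive.\<close>
    also have "\<dots> \<le> m * \<rho>"
      unfolding \<rho> m_def using nonneg \<alpha> by (intro mult_left_mono) (auto simp: le_max_iff_disj)
    finally have tail: "R_tail N P D \<le> m * \<rho>" .
    \<comment> \<open>Moving all residuals to the other side leaves only the collection of the
      coefficients of \<open>\<rho>\<close> and of the constants.\<close>
    from vis_det det core tail res show ?thesis
      unfolding \<rho>_def[symmetric] by (simp add: algebra_simps)
  qed
  then show ?thesis unfolding Let_def lam_def m_def by blast
qed

end
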